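(* Let $\mathcal{I}$ be an ideal on $\omega$ and let $x = (x_n)$ be a sequence taking values in a regular Hausdorff space $X$ such that $\{n : x_n \notin K\} \in \mathcal{I}$ for some compact set $K \subseteq X$. Then $\Gamma_x(\mathcal{I})$ is the smallest (with respect to inclusion) closed set $C \subseteq X$ such that $\{n : x_n \notin U\} \in \mathcal{I}$ for all open sets $U$ containing $C$.
   Context: $\omega$ denotes the set of positive integers. An ideal $\mathcal{I}$ on $\omega$ is a family of subsets of $\omega$ closed under finite unions and under taking subsets of its elements, different from the power set of $\omega$ and containing all singletons. $\Gamma_x(\mathcal{I})$ is the set of $\mathcal{I}$-cluster points of $x$, i.e. the set of all $\ell \in X$ such that $\{n : x_n \in U\} \notin \mathcal{I}$ for all neighborhoods $U$ of $\ell$. *)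

theory Defs
  imports "HOL-Analysis.Analysis"
begin

text \<open>The set of positive integers. Sequences have type \<^typ>\<open>nat \<Rightarrow> 'a\<close>; only their values on
  this set matter, the value at 0 is never used.\<close>

definition omega :: "nat set"  (\<open>\<omega>\<close>)
  where "\<omega> = {n. 1 \<le> n}"

definition ideal_on :: "'i set \<Rightarrow> 'i set set \<Rightarrow> bool"
  where "ideal_on S I \<longleftrightarrow>
    I \<subseteq> Pow S \<and>
    (\<forall>A\<in>I. \<forall>B\<in>I. A \<union> B \<in> I) \<and>
    (\<forall>A\<in>I. \<forall>B. B \<subseteq> A \<longrightarrow> B \<in> I) \<and>
    I \<noteq> Pow S \<and>
    (\<forall>s\<in>S. {s} \<in> I)"

text \<open>Neighborhoods of \<open>l\<close> need not be open: they are the sets with \<open>l\<close> in their interior.\<close>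

definition cluster_points :: "(nat \<Rightarrow> 'a::topological_space) \<Rightarrow> nat set set \<Rightarrow> 'a set"  (\<open>\<Gamma>\<close>)
  where "\<Gamma> x I = {l. \<forall>U. l \<in> interior U \<longrightarrow> {n \<in> \<omega>. x n \<in> U} \<notin> I}"

end

theory Submission
  imports Defs
begin

text \<open>
  A point \<open>l\<close> fails to be a cluster point exactly when some open neighbourhood of \<open>l\<close> is visited
  by the sequence only along an index set in the ideal; call such an open set negligible. Thus the
  complement of \<open>\<Gamma> x I\<close> is the union of all negligible open sets, which is why \<open>\<Gamma> x I\<close> is closed.
  If \<open>U\<close> is an open set containing \<open>\<Gamma> x I\<close>, the negligible open sets cover the compact set
  \<open>K - U\<close>. Finitely many of them suffice, and the ideal absorbs finite unions, so the sequence
  visits \<open>K - U\<close> only along an index set in \<open>I\<close> (\<open>compact_Int_cluster_points_empty_imp\<close>). Since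
  it leaves \<open>K\<close> only along an index set in \<open>I\<close>, the same holds for leaving \<open>U\<close>.

  Minimality is where regularity enters: a point outside a closed set \<open>C\<close> has an open neighbourhood
  disjoint from some open \<open>V \<supseteq> C\<close>. If the sequence leaves \<open>V\<close> only along an index set in \<open>I\<close>, that
  neighbourhood is negligible, and the point is not a cluster point
  (\<open>cluster_points_subset_closed\<close>).
\<close>

lemma ideal_on_subset: "ideal_on S I \<Longrightarrow> A \<in> I \<Longrightarrow> B \<subseteq> A \<Longrightarrow> B \<in> I"
  unfolding ideal_on_def by blast

lemma ideal_on_Un: "ideal_on S I \<Longrightarrow> A \<in> I \<Longrightarrow> B \<in> I \<Longrightarrow> A \<union> B \<in> I"
  unfolding ideal_on_def by blast

text \<open>An ideal on the empty set would have to be empty itself, as it differs from \<open>Pow {}\<close>;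
  hence the assumption \<open>S \<noteq> {}\<close>.\<close>

lemma ideal_on_empty_mem: "ideal_on S I \<Longrightarrow> S \<noteq> {} \<Longrightarrow> {} \<in> I"
  unfolding ideal_on_def by blast

lemma ideal_on_finite_UN:
  assumes "ideal_on S I" "S \<noteq> {}" "finite T" "\<And>t. t \<in> T \<Longrightarrow> A t \<in> I"
  shows "(\<Union>t\<in>T. A t) \<in> I"
  using assms(3,4)
  by (induction T rule: finite_induct)
    (auto intro: ideal_on_Un[OF assms(1)] ideal_on_empty_mem[OF assms(1,2)])

text \<open>Passing from a neighbourhood to its interior only shrinks the index set, so open
  neighbourhoods suffice to test for cluster points.\<close>

lemma not_cluster_point_iff:
  assumes "ideal_on \<omega> I"
  shows "l \<notin> \<Gamma> x I \<longleftrightarrow> (\<exists>U. open U \<and> l \<in> U \<and> {n \<in> \<omega>. x n \<in> U} \<in> I)"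
proof
  assume "l \<notin> \<Gamma> x I"
  then obtain U where U: "l \<in> interior U" "{n \<in> \<omega>. x n \<in> U} \<in> I"
    unfolding cluster_points_def by blast
  have "{n \<in> \<omega>. x n \<in> interior U} \<subseteq> {n \<in> \<omega>. x n \<in> U}"
    using interior_subset by blast
  with U ideal_on_subset[OF assms] show "\<exists>U. open U \<and> l \<in> U \<and> {n \<in> \<omega>. x n \<in> U} \<in> I"
    using open_interior by blast
next
  assume "\<exists>U. open U \<and> l \<in> U \<and> {n \<in> \<omega>. x n \<in> U} \<in> I"
  then show "l \<notin> \<Gamma> x I"
    unfolding cluster_points_def using interior_open by blast
qed

lemma closed_cluster_points:
  assumes "ideal_on \<omega> I"
  shows "closed (\<Gamma> x I)"
proof -
  have "- \<Gamma> x I = \<Union>{U. open U \<and> {n \<in> \<omega>. x n \<in> U} \<in> I}"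
    using not_cluster_point_iff[OF assms] by blast
  then show ?thesis
    by (auto simp: closed_def)
qed

text \<open>Compactness upgrades the local statement that each point of \<open>K\<close> has a neighbourhood visited
  rarely to the global one: \<open>K\<close> lies in a finite union of such neighbourhoods.\<close>

lemma compact_Int_cluster_points_empty_imp:
  assumes I: "ideal_on \<omega> I" and "compact K" and "K \<inter> \<Gamma> x I = {}"
  shows "{n \<in> \<omega>. x n \<in> K} \<in> I"
proof -
  define N where "N = {U. open U \<and> {n \<in> \<omega>. x n \<in> U} \<in> I}"
  have "K \<subseteq> \<Union>N"
    using assms(3) not_cluster_point_iff[OF I] unfolding N_def by blast
  moreover have "\<forall>U\<in>N. open U"
    unfolding N_def by blast
  ultimately obtain D where D: "D \<subseteq> N" "finite D" "K \<subseteq> \<Union>D"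
    using compactE[OF \<open>compact K\<close>] by metis
  have "\<omega> \<noteq> {}"
    unfolding omega_def by blast
  then have "(\<Union>U\<in>D. {n \<in> \<omega>. x n \<in> U}) \<in> I"
    by (rule ideal_on_finite_UN[OF I _ D(2)]) (use D(1) N_def in blast)
  moreover have "{n \<in> \<omega>. x n \<in> K} \<subseteq> (\<Union>U\<in>D. {n \<in> \<omega>. x n \<in> U})"
    using D(3) by blast
  ultimately show ?thesis
    by (rule ideal_on_subset[OF I])
qed

lemma cluster_points_subset_closed:
  fixes x :: "nat \<Rightarrow> 'a::t3_space"
  assumes I: "ideal_on \<omega> I" and "closed C"
    and C: "\<And>U. open U \<Longrightarrow> C \<subseteq> U \<Longrightarrow> {n \<in> \<omega>. x n \<notin> U} \<in> I"
  shows "\<Gamma> x I \<subseteq> C"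
proof (rule ccontr)
  assume "\<not> \<Gamma> x I \<subseteq> C"
  then obtain l where l: "l \<in> \<Gamma> x I" "l \<notin> C"
    by blast
  obtain U V where UV: "open U" "open V" "l \<in> U" "C \<subseteq> V" "U \<inter> V = {}"
    using t3_space[OF \<open>closed C\<close> l(2)] by blast
  have "{n \<in> \<omega>. x n \<in> U} \<subseteq> {n \<in> \<omega>. x n \<notin> V}"
    using UV(5) by blast
  with C[OF UV(2,4)] have "{n \<in> \<omega>. x n \<in> U} \<in> I"
    by (rule ideal_on_subset[OF I])
  with UV l(1) show False
    using not_cluster_point_iff[OF I] by blast
qed

theorem theorem4p3:
  fixes x :: "nat \<Rightarrow> 'a::t3_space" and I :: "nat set set"
  assumes "ideal_on \<omega> I"
    and "\<exists>K. compact K \<and> {n \<in> \<omega>. x n \<notin> K} \<in> I"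
  defines "F \<equiv> {C. closed C \<and> (\<forall>U. open U \<and> C \<subseteq> U \<longrightarrow> {n \<in> \<omega>. x n \<notin> U} \<in> I)}"
  shows "\<Gamma> x I \<in> F \<and> (\<forall>C\<in>F. \<Gamma> x I \<subseteq> C)"
proof
  obtain K where K: "compact K" "{n \<in> \<omega>. x n \<notin> K} \<in> I"
    using assms(2) by blast
  have "{n \<in> \<omega>. x n \<notin> U} \<in> I" if U: "open U" "\<Gamma> x I \<subseteq> U" for U
  proof -
    have "{n \<in> \<omega>. x n \<in> K - U} \<in> I"
      using compact_diff[OF K(1) U(1)] U(2)
      by (intro compact_Int_cluster_points_empty_imp[OF assms(1)]) auto
    from ideal_on_Un[OF assms(1) K(2) this] show ?thesis
      by (rule ideal_on_subset[OF assms(1)]) blast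
  qed
  then show "\<Gamma> x I \<in> F"
    unfolding F_def using closed_cluster_points[OF assms(1)] by blast
next
  show "\<forall>C\<in>F. \<Gamma> x I \<subseteq> C"
    unfolding F_def using cluster_points_subset_closed[OF assms(1)] by blast
qed

end
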